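(* Let $X$ be a Banach space over $\mathbb{K}\in\{\mathbb{R},\mathbb{C}\}$, $m\in\mathbb{N}^+$, and suppose $T\in B(X)$ is an invertible $(m,\infty)$-isometry. (i) $T^{-1}$ is an $(m,\infty)$-isometry. (ii) If $m$ is even, then $T$ is an $(m-1,\infty)$-isometry.
   Context: $\mathbb{N}^+$ denotes the positive integers; $B(X)$ is the algebra of bounded linear operators on $X$. For $m\in\mathbb{N}^+$, an operator $T\in B(X)$ is an $(m,\infty)$-isometry if for all $x\in X$ $$\max_{\substack{k=0,\dots,m\\ k\text{ even}}}\|T^kx\|=\max_{\substack{k=0,\dots,m\\ k\text{ odd}}}\|T^kx\|.$$ *)

theory Defs
  imports Complex_Main
begin

text \<open>
  The scalar fields: a normed field in this class is isometrically isomorphic, via \<open>f\<close>, to the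
  reals or to the complex numbers, the two cases being distinguished by the range of \<open>f\<close>.
\<close>

class real_or_complex = real_normed_field +
  assumes real_or_complex: "\<exists>f :: 'a \<Rightarrow> complex.
    (\<forall>a b. f (a + b) = f a + f b) \<and> (\<forall>a b. f (a * b) = f a * f b) \<and>
    (\<forall>r. f (scaleR r 1) = complex_of_real r) \<and>
    (\<forall>a. cmod (f a) = norm a) \<and> (range f = \<real> \<or> range f = UNIV)"

instance real :: real_or_complex
  by standard (rule exI[of _ complex_of_real], auto simp: Reals_def)

instance complex :: real_or_complex
  by standard (rule exI[of _ "\<lambda>z. z"], auto simp: of_real_def)

text \<open>
  A Banach space over the scalar field \<open>'k\<close>. The class \<open>banach\<close> supplies the complete norm and the
  underlying real vector space, which \<open>scale\<close> has to extend. For \<open>'k = real\<close> the only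
  choice is \<open>scale = scaleR\<close>, so that one gets exactly the real Banach spaces.
\<close>

locale banach_space_over = vector_space scale
  for scale :: "'k::real_or_complex \<Rightarrow> 'x::banach \<Rightarrow> 'x" +
  assumes scale_of_real: "scale (of_real r) x = r *\<^sub>R x"
    and norm_scale: "norm (scale c x) = norm c * norm x"

definition bounded_operators ::
  "('k::field \<Rightarrow> 'x::real_normed_vector \<Rightarrow> 'x) \<Rightarrow> ('x \<Rightarrow> 'x) set" where
  "bounded_operators scale =
     {T. Vector_Spaces.linear scale scale T \<and> (\<exists>C. \<forall>x. norm (T x) \<le> C * norm x)}"

text \<open>Invertibility is meant in the algebra of bounded operators; the inverse is then \<open>inv T\<close>.\<close>

definition invertible_operator ::
  "('k::field \<Rightarrow> 'x::real_normed_vector \<Rightarrow> 'x) \<Rightarrow> ('x \<Rightarrow> 'x) \<Rightarrow> bool" where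
  "invertible_operator scale T \<longleftrightarrow>
     T \<in> bounded_operators scale \<and>
     (\<exists>S \<in> bounded_operators scale. S \<circ> T = id \<and> T \<circ> S = id)"

text \<open>Only meaningful for \<open>m \<ge> 1\<close>: for \<open>m = 0\<close> there is no odd index and \<open>Max {}\<close> is unspecified.\<close>

definition m_infinity_isometry ::
  "('k::field \<Rightarrow> 'x::real_normed_vector \<Rightarrow> 'x) \<Rightarrow> nat \<Rightarrow> ('x \<Rightarrow> 'x) \<Rightarrow> bool" where
  "m_infinity_isometry scale m T \<longleftrightarrow>
     T \<in> bounded_operators scale \<and>
     (\<forall>x. Max {norm ((T ^^ k) x) | k. k \<le> m \<and> even k} =
          Max {norm ((T ^^ k) x) | k. k \<le> m \<and> odd k})"

end

theory Submission imports Defs begin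

text \<open>
  Put \<open>a\<^sub>k = \<parallel>T\<^sup>k x\<parallel>\<close> for every integer \<open>k\<close>, which makes sense as \<open>T\<close> is
  invertible. As \<open>x\<close> is arbitrary, the defining identity of an \<open>(m,\<infinity>)\<close>-isometry holds on every
  window \<open>n, \<dots>, n + m\<close> of this two-sided sequence.

  Passing to the inverse reverses the sequence, hence reverses each window. The reflection
  \<open>k \<mapsto> m - k\<close> preserves parities if \<open>m\<close> is even and exchanges them if \<open>m\<close> is odd; the identity
  is symmetric in the two parities, so it survives in both cases
  (\<open>m_infinity_isometry_inv\<close>).

  Let \<open>m\<close> be even and let \<open>E\<^sub>n\<close> be the maximum of \<open>a\<^sub>n, a\<^sub>n\<^sub>+\<^sub>2, \<dots>, a\<^sub>n\<^sub>+\<^sub>m\<^sub>-\<^sub>2\<close>. The identity on the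
  window at \<open>n\<close> reads \<open>max E\<^sub>n a\<^sub>n\<^sub>+\<^sub>m = E\<^sub>n\<^sub>+\<^sub>1 = max a\<^sub>n E\<^sub>n\<^sub>+\<^sub>2\<close>. Hence \<open>E\<close> is both increasing (first
  equation) and decreasing (second equation), so \<open>E\<^sub>n = E\<^sub>n\<^sub>+\<^sub>1\<close>, which is the identity for
  \<open>m - 1\<close> (\<open>m_infinity_isometry_diff_one\<close>). The inequality \<open>E\<^sub>1 \<le> E\<^sub>0\<close> comes
  from the window at \<open>-1\<close>, and this is where a preimage of \<open>x\<close> under \<open>T\<close> enters.
\<close>

lemma funpow_apply_funpow_inv:
  assumes "bij T" "k \<le> m"
  shows "(T ^^ (m - k)) ((inv T ^^ m) x) = (inv T ^^ k) x"
proof -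
  have cancel: "(T ^^ j) ((inv T ^^ j) z) = z" for j z
    using bij_fn[OF assms(1), of j] inv_fn[OF assms(1), of j]
    by (metis bij_inv_eq_iff)
  have "(inv T ^^ m) x = (inv T ^^ (m - k)) ((inv T ^^ k) x)"
    using assms(2) by (metis comp_apply funpow_add le_add_diff_inverse2)
  then show ?thesis
    by (simp add: cancel)
qed

lemma invertible_operator_bij_inv_bounded:
  assumes "invertible_operator scale T"
  shows "bij T" "inv T \<in> bounded_operators scale"
proof -
  obtain S where S: "S \<in> bounded_operators scale" "S \<circ> T = id" "T \<circ> S = id"
    using assms unfolding invertible_operator_def by blast
  show "bij T"
    using S(2,3) o_bij by blast
  have "inv T = S"
    using S(2,3) by (rule inv_unique_comp[rotated])
  with S(1) show "inv T \<in> bounded_operators scale"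
    by simp
qed

text \<open>
  Starting at \<open>y = T\<^sup>-\<^sup>m x\<close>, the forward orbit \<open>y, T y, \<dots>, T\<^sup>m y\<close> is the backward orbit of \<open>x\<close>
  read in the opposite direction. So the identity wanted for the inverse at \<open>x\<close> is the one
  for \<open>T\<close> at \<open>y\<close>, with its two sides exchanged if \<open>m\<close> is odd.
\<close>

lemma m_infinity_isometry_inv:
  assumes "bij T" "inv T \<in> bounded_operators scale" "m_infinity_isometry scale m T"
  shows "m_infinity_isometry scale m (inv T)"
  unfolding m_infinity_isometry_def
proof (intro conjI allI)
  show "inv T \<in> bounded_operators scale"
    by fact
next
  fix x
  let ?y = "(inv T ^^ m) x"
  have reflect: "{norm ((inv T ^^ k) x) | k. k \<le> m \<and> P k} =
      {norm ((T ^^ k) ?y) | k. k \<le> m \<and> P (m - k)}" for P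
  proof safe
    fix k assume "k \<le> m" "P k"
    then show "\<exists>j. norm ((inv T ^^ k) x) = norm ((T ^^ j) ?y) \<and> j \<le> m \<and> P (m - j)"
      by (intro exI[of _ "m - k"]) (simp add: funpow_apply_funpow_inv[OF assms(1)])
  next
    fix k assume "k \<le> m" "P (m - k)"
    then show "\<exists>j. norm ((T ^^ k) ?y) = norm ((inv T ^^ j) x) \<and> j \<le> m \<and> P j"
      using funpow_apply_funpow_inv[OF assms(1), of "m - k" m x]
      by (intro exI[of _ "m - k"]) simp
  qed
  have iso: "Max {norm ((T ^^ k) ?y) | k. k \<le> m \<and> even k} =
      Max {norm ((T ^^ k) ?y) | k. k \<le> m \<and> odd k}"
    using assms(3) unfolding m_infinity_isometry_def by blast
  show "Max {norm ((inv T ^^ k) x) | k. k \<le> m \<and> even k} =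
      Max {norm ((inv T ^^ k) x) | k. k \<le> m \<and> odd k}"
  proof (cases "even m")
    case True
    then have "k \<le> m \<and> even (m - k) \<longleftrightarrow> k \<le> m \<and> even k"
      and "k \<le> m \<and> odd (m - k) \<longleftrightarrow> k \<le> m \<and> odd k" for k
      by auto
    then show ?thesis
      using iso by (simp only: reflect)
  next
    case False
    then have "k \<le> m \<and> even (m - k) \<longleftrightarrow> k \<le> m \<and> odd k"
      and "k \<le> m \<and> odd (m - k) \<longleftrightarrow> k \<le> m \<and> even k" for k
      by auto
    then show ?thesis
      using iso by (simp only: reflect)
  qed
qed

text \<open>
  For even \<open>m\<close> the odd indices up to \<open>m\<close> lie strictly inside the window, so the odd maximum at
  \<open>x\<close> is the same for \<open>m\<close> and \<open>m - 1\<close>, and only the even maximum could drop. That it does not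
  is seen from a preimage of \<open>x\<close>, where all indices go up by one and the parities are
  exchanged: there the odd maximum consists of just the even terms to be kept.
\<close>

lemma m_infinity_isometry_diff_one:
  assumes "surj T" "m_infinity_isometry scale m T" "even m" "m \<ge> 1"
  shows "m_infinity_isometry scale (m - 1) T"
  unfolding m_infinity_isometry_def
proof (intro conjI allI)
  show "T \<in> bounded_operators scale"
    using assms(2) unfolding m_infinity_isometry_def by blast
next
  fix x
  have iso: "Max {norm ((T ^^ k) z) | k. k \<le> m \<and> even k} =
      Max {norm ((T ^^ k) z) | k. k \<le> m \<and> odd k}" for z
    using assms(2) unfolding m_infinity_isometry_def by blast
  have m: "m \<ge> 2"
    using assms(3,4) by (cases "m = 1") auto
  have odd_bound: "k \<le> m \<and> odd k \<longleftrightarrow> k \<le> m - 1 \<and> odd k" for k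
    using assms(3) m by (cases "k = m") auto
  let ?E = "{norm ((T ^^ k) x) | k. k \<le> m - 1 \<and> even k}"
  let ?O = "{norm ((T ^^ k) x) | k. k \<le> m - 1 \<and> odd k}"
  obtain y where y: "x = T y"
    using assms(1) by (meson surjD)
  have shift: "(T ^^ k) x = (T ^^ Suc k) y" for k
    by (simp add: y funpow_swap1)
  have E: "finite ?E" "?E \<noteq> {}"
    by (auto intro: exI[of _ 0])
  have O: "finite ?O" "?O \<noteq> {}"
    using m by (auto intro!: exI[of _ 1])
  show "Max ?E = Max ?O"
  proof (rule antisym)
    have "Max ?E \<le> Max {norm ((T ^^ k) x) | k. k \<le> m \<and> even k}"
      by (rule Max_mono) (use E in auto)
    also have "\<dots> = Max ?O"
      by (simp only: iso odd_bound)
    finally show "Max ?E \<le> Max ?O" .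
  next
    have "Max ?O \<le> Max {norm ((T ^^ k) y) | k. k \<le> m \<and> even k}"
    proof (rule Max_mono)
      show "?O \<subseteq> {norm ((T ^^ k) y) | k. k \<le> m \<and> even k}"
      proof safe
        fix k assume "k \<le> m - 1" "odd k"
        then show "\<exists>j. norm ((T ^^ k) x) = norm ((T ^^ j) y) \<and> j \<le> m \<and> even j"
          using m by (intro exI[of _ "Suc k"]) (simp only: shift, auto)
      qed
    qed (use O in auto)
    also have "\<dots> = Max {norm ((T ^^ k) y) | k. k \<le> m \<and> odd k}"
      by (rule iso)
    also have "\<dots> \<le> Max ?E"
    proof (rule Max_mono)
      show "{norm ((T ^^ k) y) | k. k \<le> m \<and> odd k} \<subseteq> ?E"
      proof safe
        fix k assume k: "k \<le> m" "odd k"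
        then obtain j where "k = Suc j"
          by (cases k) auto
        with k show "\<exists>j. norm ((T ^^ k) y) = norm ((T ^^ j) x) \<and> j \<le> m - 1 \<and> even j"
          by (intro exI[of _ j]) (simp only: shift, auto)
      qed
      show "{norm ((T ^^ k) y) | k. k \<le> m \<and> odd k} \<noteq> {}"
        using m by (auto intro!: exI[of _ 1])
    qed (use E in auto)
    finally show "Max ?O \<le> Max ?E" .
  qed
qed

theorem proposition6p4:
  fixes scale :: "'k::real_or_complex \<Rightarrow> 'x::banach \<Rightarrow> 'x"
    and T :: "'x \<Rightarrow> 'x" and m :: nat
  assumes "banach_space_over scale"
    and "m \<ge> 1"
    and "invertible_operator scale T"
    and "m_infinity_isometry scale m T"
  shows "m_infinity_isometry scale m (inv T) \<and>
         (even m \<longrightarrow> m_infinity_isometry scale (m - 1) T)"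
proof (intro conjI impI)
  note inverse = invertible_operator_bij_inv_bounded[OF assms(3)]
  show "m_infinity_isometry scale m (inv T)"
    using inverse assms(4) by (rule m_infinity_isometry_inv)
  show "m_infinity_isometry scale (m - 1) T" if "even m"
    using bij_is_surj[OF inverse(1)] assms(4) that assms(2)
    by (rule m_infinity_isometry_diff_one)
qed

end
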